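(* Assume that $f,g,h:(1,\infty)\to(1,\infty)$ are continuous, strictly increasing, and onto. Then $C_{f,g}$, $C_{g,h}$, and $C_{f\circ g,\,g\circ h}$ are means in $(1,\infty)$ if and only if $$g=\prod_{i=0}^{\infty}h^{-i},\qquad f=\prod_{j=0}^{\infty}\left(\prod_{i=0}^{\infty}h^{-i}\right)^{-j},$$ and $h$ satisfies the composite functional equation $$\prod_{j=0}^{\infty}\left(\prod_{i=0}^{\infty}h^{-i}\right)^{-j+1}=\prod_{k=0}^{\infty}\left(\prod_{i=0}^{\infty}h^{-i+1}\right)^{-k},$$ where $i,j,k$ stand for the indices of iterates of the suitable functions.
   Context: For bijections $f,g$ of $I=(1,\infty)$, $C_{f,g}:I^2\to I$ is defined by $C_{f,g}(x,y)=(f\circ g)^{-1}(f(x)\cdot g(y))$, where $\circ$ is composition and $(\cdot)^{-1}$ applied to a function is its inverse function. For a bijection $u$ of $(1,\infty)$ and an integer $n\ge 0$, $u^{-n}$ denotes the $n$th iterate (under composition) of the inverse function $u^{-1}$, $u^0$ is the identity, and $u^1=u$. Infinite products of functions are pointwise: e.g. $\prod_{i=0}^\infty h^{-i}$ is the function $x\mapsto\prod_{i=0}^\infty h^{-i}(x)$, and $\prod_{i=0}^\infty h^{-i+1}$ is $x\mapsto h(x)\cdot x\cdot h^{-1}(x)\cdot h^{-2}(x)\cdots$. An expression such as $\left(\prod_{i=0}^{\infty}h^{-i}\right)^{-j}$ is the $j$th iterate of the inverse of the function $\prod_{i=0}^\infty h^{-i}$ (not a power). The stated equalities include that the infinite products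 involved converge. A function $M:I^2\to\mathbb{R}$ is a mean in $I$ if $\min(x,y)\le M(x,y)\le\max(x,y)$ for all $x,y\in I$. *)

theory Defs
  imports "HOL-Analysis.Analysis"
begin

abbreviation I1 :: "real set" where
  "I1 \<equiv> {1<..}"

(* Functions on (1,\<infinity>) are total real functions of which only the restriction to I1 matters;
   inverses are therefore taken relative to I1. *)

definition C :: "(real \<Rightarrow> real) \<Rightarrow> (real \<Rightarrow> real) \<Rightarrow> real \<Rightarrow> real \<Rightarrow> real" where
  "C f g x y = inv_into I1 (f \<circ> g) (f x * g y)"

definition is_mean :: "(real \<Rightarrow> real \<Rightarrow> real) \<Rightarrow> bool" where
  "is_mean M \<longleftrightarrow> (\<forall>x\<in>I1. \<forall>y\<in>I1. min x y \<le> M x y \<and> M x y \<le> max x y)"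

(* Meaningful for bijections u of I1 only. *)
definition iter :: "(real \<Rightarrow> real) \<Rightarrow> int \<Rightarrow> real \<Rightarrow> real" where
  "iter u k = (if k \<ge> 0 then u ^^ nat k else inv_into I1 u ^^ nat (- k))"

definition fprod_converges :: "(nat \<Rightarrow> real \<Rightarrow> real) \<Rightarrow> bool" where
  "fprod_converges u \<longleftrightarrow> (\<forall>x\<in>I1. convergent_prod (\<lambda>i. u i x))"

(* The value is arbitrary where the product diverges, so use together with fprod_converges. *)
definition fprod :: "(nat \<Rightarrow> real \<Rightarrow> real) \<Rightarrow> real \<Rightarrow> real" where
  "fprod u x = (\<Prod>i. u i x)"

end

theory Submission
  imports Defs
begin

text \<open>
  An increasing bijection pair \<open>f\<close>, \<open>g\<close> gives a mean \<open>C f g\<close> iff \<open>C f g\<close> is reflexive, that is, iff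
  \<open>f (g x) = f x * g x\<close> on \<open>I1\<close>. Reading this equation as \<open>f y = y * f (g\<^sup>-\<^sup>1 y)\<close> and iterating it
  gives \<open>f y = (\<Prod>i<n. g\<^sup>-\<^sup>i y) * f (g\<^sup>-\<^sup>n y)\<close>, where \<open>g\<^sup>-\<^sup>n y\<close> decreases to 1 and
  hence the last factor tends to 1. So \<open>C f g\<close> is a mean iff \<open>f\<close> is the product of the
  iterates \<open>g\<^sup>-\<^sup>i\<close>. Moreover, multiplying this product by \<open>g\<close> gives \<open>f \<circ> g\<close>, so that the composite
  functional equation for \<open>h\<close> says that \<open>f \<circ> g\<close> is the product of the iterates \<open>(g \<circ> h)\<^sup>-\<^sup>k\<close>.
\<close>

definition incr_bij :: "(real \<Rightarrow> real) \<Rightarrow> bool" where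
  "incr_bij u \<longleftrightarrow> strict_mono_on I1 u \<and> u ` I1 = I1"

lemma incr_bij_less_iff:
  assumes "incr_bij u" "x > 1" "y > 1"
  shows "u x < u y \<longleftrightarrow> x < y"
  using assms strict_mono_on_less[of I1 u x y] by (auto simp: incr_bij_def)

lemma incr_bij_gt_1: "incr_bij u \<Longrightarrow> x > 1 \<Longrightarrow> u x > 1"
  by (auto simp: incr_bij_def)

lemma incr_bij_inv:
  assumes "incr_bij u" "y > 1"
  shows "inv_into I1 u y > 1" "u (inv_into I1 u y) = y"
  using assms inv_into_into[of y u I1] f_inv_into_f[of y u I1] by (auto simp: incr_bij_def)

lemma incr_bij_inv_left:
  assumes "incr_bij u" "x > 1"
  shows "inv_into I1 u (u x) = x"
  using assms by (intro inv_into_f_f) (auto simp: incr_bij_def strict_mono_on_imp_inj_on)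

lemma incr_bij_comp:
  assumes "incr_bij u" "incr_bij v"
  shows "incr_bij (u \<circ> v)"
proof -
  have "(u \<circ> v) ` I1 = I1"
    unfolding image_comp[symmetric] using assms by (simp add: incr_bij_def)
  moreover have "strict_mono_on I1 (u \<circ> v)"
    using assms incr_bij_less_iff incr_bij_gt_1 by (auto intro!: strict_mono_onI)
  ultimately show ?thesis by (simp add: incr_bij_def)
qed

text \<open>A mean satisfies \<open>C f g x x = x\<close>, and applying \<open>f \<circ> g\<close>
  turns this into the equation. Conversely, monotonicity puts \<open>f x * g y\<close> between the
  values of \<open>f \<circ> g\<close> at \<open>min x y\<close> and \<open>max x y\<close>.\<close>

lemma is_mean_C_iff:
  assumes "incr_bij f" "incr_bij g"
  shows "is_mean (C f g) \<longleftrightarrow> (\<forall>x>1. f (g x) = f x * g x)"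
proof
  note fg = incr_bij_comp[OF assms]
  have prod: "f x * g y > 1" if "x > 1" "y > 1" for x y
    using that incr_bij_gt_1 assms by (simp add: less_1_mult)
  have C: "C f g x y > 1" "f (g (C f g x y)) = f x * g y" if "x > 1" "y > 1" for x y
    using incr_bij_inv[OF fg prod[OF that]] by (auto simp: C_def)
  show "\<forall>x>1. f (g x) = f x * g x" if mean: "is_mean (C f g)"
  proof (intro allI impI)
    fix x :: real assume x: "x > 1"
    then have "C f g x x = x"
      using mean by (force simp: is_mean_def)
    then show "f (g x) = f x * g x"
      using C(2)[OF x x] by simp
  qed
  show "is_mean (C f g)" if eq: "\<forall>x>1. f (g x) = f x * g x"
    unfolding is_mean_def
  proof (intro ballI)
    fix x y :: real assume "x \<in> I1" "y \<in> I1"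
    then have xy: "x > 1" "y > 1" by auto
    define m where "m = min x y"
    define M where "M = max x y"
    have mM: "m > 1" "M > 1" "m \<le> x" "m \<le> y" "x \<le> M" "y \<le> M"
      using xy by (auto simp: m_def M_def)
    have le: "f s \<le> f t" "g s \<le> g t" if "s > 1" "t > 1" "s \<le> t" for s t
      using that incr_bij_less_iff[OF assms(1), of t s] incr_bij_less_iff[OF assms(2), of t s]
      by linarith+
    have pos: "0 \<le> f t" "0 \<le> g t" if "t > 1" for t
      using incr_bij_gt_1[OF assms(1) that] incr_bij_gt_1[OF assms(2) that] by simp_all
    have "f (g m) \<le> f x * g y"
    proof -
      have "f (g m) = f m * g m" using eq mM by blast
      also have "\<dots> \<le> f x * g y"
        by (intro mult_mono le pos mM xy)
      finally show ?thesis .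
    qed
    moreover have "f x * g y \<le> f (g M)"
    proof -
      have "f x * g y \<le> f M * g M"
        by (intro mult_mono le pos mM xy)
      also have "\<dots> = f (g M)" using eq mM by simp
      finally show ?thesis .
    qed
    ultimately have "m \<le> C f g x y" "C f g x y \<le> M"
      using C[OF xy] mM incr_bij_less_iff[OF fg, of "C f g x y" m]
        incr_bij_less_iff[OF fg, of M "C f g x y"] by auto
    then show "min x y \<le> C f g x y \<and> C f g x y \<le> max x y"
      by (simp add: m_def M_def)
  qed
qed

lemma iter_minus: "iter u (- int n) = inv_into I1 u ^^ n"
  by (auto simp: iter_def)

lemma iter_minus_plus_1:
  "iter u (- int 0 + 1) = u" "iter u (- int (Suc n) + 1) = inv_into I1 u ^^ n"
  using iter_minus[of u n] by (simp_all add: iter_def)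

text \<open>The choice in \<open>inv_into\<close> ranges over \<open>A\<close> only, so the inverses
  agree as total functions, even at points outside the image of \<open>A\<close>.\<close>

lemma inv_into_cong:
  assumes "\<And>x. x \<in> A \<Longrightarrow> u x = v x"
  shows "inv_into A u = inv_into A v"
  using assms by (auto simp: inv_into_def fun_eq_iff cong: conj_cong)

lemma iter_minus_cong:
  assumes "\<And>x. x > 1 \<Longrightarrow> u x = v x"
  shows "iter u (- int n) = iter v (- int n)"
  using inv_into_cong[of I1 u v] assms by (simp add: iter_minus)

lemma has_prod_iter_minus:
  assumes f: "incr_bij f" and g: "incr_bij g" and eq: "\<And>x. x > 1 \<Longrightarrow> f (g x) = f x * g x"
    and y: "y > 1"
  shows "(\<lambda>i. iter g (- int i) y) has_prod f y"
proof -
  define a where "a n = (inv_into I1 g ^^ n) y" for n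
  have a_Suc: "a (Suc n) = inv_into I1 g (a n)" for n
    by (simp add: a_def)
  have a_gt: "a n > 1" for n
    by (induction n) (use y g incr_bij_inv in \<open>auto simp: a_def\<close>)
  have ga: "g (a (Suc n)) = a n" for n
    using incr_bij_inv(2)[OF g a_gt] by (simp add: a_Suc)
  have fa: "f (a n) = f (a (Suc n)) * a n" for n
    using eq[OF a_gt, of "Suc n"] by (simp add: ga)
  have fa_gt: "f (a n) > 1" for n
    using incr_bij_gt_1 f a_gt by blast
  have fy: "f y = (\<Prod>i<n. a i) * f (a n)" for n
  proof (induction n)
    case 0
    then show ?case by (simp add: a_def)
  next
    case (Suc n)
    then show ?case using fa[of n] by simp
  qed
  have "a (Suc n) < a n" for n
  proof -
    have "f (a (Suc n)) < f (a n)"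
      using fa[of n] fa_gt[of "Suc n"] a_gt[of n] by simp
    then show ?thesis
      using incr_bij_less_iff[OF f a_gt a_gt] by blast
  qed
  then have dec: "decseq a"
    by (intro decseq_SucI less_imp_le)
  \<comment> \<open>Otherwise the partial products, which are at most \<open>f y\<close>, would be at least \<open>t ^ n\<close>.\<close>
  have small: "\<exists>N. a N < t" if t: "t > 1" for t
  proof (rule ccontr)
    assume "\<not> ?thesis"
    then have ge: "t \<le> a n" for n by (simp add: not_less)
    obtain n where n: "f y < t ^ n" using real_arch_pow[OF t] by blast
    have "t ^ n = (\<Prod>i<n. t)" by simp
    also have "\<dots> \<le> (\<Prod>i<n. a i)"
      using t ge by (intro prod_mono) auto
    also have "\<dots> \<le> (\<Prod>i<n. a i) * f (a n)"
    proof -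
      have "0 \<le> a i" for i using a_gt[of i] by simp
      then have "(\<Prod>i<n. a i) * 1 \<le> (\<Prod>i<n. a i) * f (a n)"
        using fa_gt[of n] by (intro mult_left_mono prod_nonneg) simp_all
      then show ?thesis by simp
    qed
    also have "\<dots> = f y" using fy by simp
    finally show False using n by simp
  qed
  \<comment> \<open>Surjectivity of \<open>f\<close> supplies \<open>t\<close> with
    \<open>f t = 1 + e\<close>. Once the decreasing sequence \<open>a\<close> is below
    \<open>t\<close>, monotonicity keeps \<open>f (a n)\<close> between 1 and
    \<open>1 + e\<close>.\<close>
  have "(\<lambda>n. f (a n)) \<longlonglongrightarrow> 1"
  proof (rule LIMSEQ_I)
    fix e :: real assume e: "e > 0"
    then have "1 + e \<in> f ` I1" using f by (simp add: incr_bij_def)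
    then obtain t where t: "t > 1" "f t = 1 + e" by force
    obtain N where N: "a N < t" using small t by blast
    have "norm (f (a n) - 1) < e" if "n \<ge> N" for n
    proof -
      have "a n < t" using decseqD[OF dec that] N by simp
      then have "f (a n) < 1 + e" using incr_bij_less_iff[OF f a_gt t(1)] t(2) by metis
      then show ?thesis using fa_gt[of n] by simp
    qed
    then show "\<exists>N. \<forall>n\<ge>N. norm (f (a n) - 1) < e" by blast
  qed
  then have "(\<lambda>n. f y / f (a n)) \<longlonglongrightarrow> f y / 1"
    by (intro tendsto_divide tendsto_const) auto
  moreover have "f y / f (a n) = (\<Prod>i<n. a i)" for n
    using fy[of n] fa_gt[of n] by (simp add: field_simps)
  ultimately have "(\<lambda>n. \<Prod>i<n. a i) \<longlonglongrightarrow> f y" by simp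
  then have "(\<lambda>n. \<Prod>i\<le>n. a i) \<longlonglongrightarrow> f y"
    using LIMSEQ_Suc by (fastforce simp: lessThan_Suc_atMost)
  \<comment> \<open>\<open>raw_has_prod\<close> demands a nonzero limit of the partial
    products.\<close>
  moreover have "f y \<noteq> 0" using incr_bij_gt_1[OF f y] by simp
  ultimately have "a has_prod f y"
    by (simp add: has_prod_def raw_has_prod_def)
  then show ?thesis by (simp add: iter_minus a_def[abs_def])
qed

lemma inv_iterate_gt_1:
  assumes "incr_bij g" "y > 1"
  shows "(inv_into I1 g ^^ n) y > 1"
  by (induction n) (use assms incr_bij_inv in auto)

text \<open>For the converse direction, the factors at \<open>g x\<close> are \<open>g x\<close>
  followed by the factors at \<open>x\<close>, so uniqueness of the product gives the
  equation.\<close>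

lemma mult_eq_iff_has_prod:
  assumes f: "incr_bij f" and g: "incr_bij g"
  shows "(\<forall>x>1. f (g x) = f x * g x) \<longleftrightarrow> (\<forall>x>1. (\<lambda>i. iter g (- int i) x) has_prod f x)"
proof
  show "\<forall>x>1. f (g x) = f x * g x" if prod: "\<forall>x>1. (\<lambda>i. iter g (- int i) x) has_prod f x"
  proof (intro allI impI)
    fix x :: real assume x: "x > 1"
    define a where "a n = (inv_into I1 g ^^ n) (g x)" for n
    have gx: "g x > 1" using incr_bij_gt_1[OF g x] .
    have a_nz: "a n \<noteq> 0" for n
      using inv_iterate_gt_1[OF g gx, of n] by (simp add: a_def)
    have "a (Suc n) = iter g (- int n) x" for n
      using incr_bij_inv_left[OF g x] by (simp add: a_def iter_minus funpow_swap1)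
    then have "(\<lambda>n. a (Suc n)) has_prod f x"
      using prod x by simp
    then have "a has_prod (f x * a 0)"
      using has_prod_Suc_iff[of a, OF a_nz] by blast
    moreover have "a has_prod f (g x)"
      using prod gx by (simp add: a_def[abs_def] iter_minus)
    ultimately show "f (g x) = f x * g x"
      using has_prod_unique2 by (fastforce simp: a_def mult.commute)
  qed
qed (use has_prod_iter_minus[OF assms] in blast)

lemma has_prod_iter_minus_plus_1:
  assumes g: "incr_bij g" and x: "x > 1" and p: "(\<lambda>i. iter g (- int i) x) has_prod p"
  shows "(\<lambda>i. iter g (- int i + 1) x) has_prod (p * g x)"
proof -
  define a where "a n = iter g (- int n + 1) x" for n
  have a0: "a 0 = g x" and a_Suc: "a (Suc n) = (inv_into I1 g ^^ n) x" for n
    by (simp_all only: a_def iter_minus_plus_1)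
  have "a n \<noteq> 0" for n
    using inv_iterate_gt_1[OF g x, of "n - 1"] incr_bij_gt_1[OF g x] a0 a_Suc[of "n - 1"]
    by (cases n) simp_all
  moreover have "(\<lambda>n. a (Suc n)) has_prod p"
    using p by (simp add: a_Suc iter_minus)
  ultimately have "a has_prod (p * a 0)"
    using has_prod_Suc_iff[of a] by blast
  then show ?thesis by (simp only: a0) (simp only: a_def[abs_def])
qed

text \<open>Since \<open>fprod\<close> carries no information where the product diverges,
  convergence and value are handled together as one \<open>has_prod\<close> statement.\<close>

lemma fprod_iff:
  "fprod_converges u \<and> (\<forall>x\<in>I1. f x = fprod u x) \<longleftrightarrow> (\<forall>x>1. (\<lambda>i. u i x) has_prod f x)"
  by (auto simp: fprod_converges_def fprod_def has_prod_iff)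

lemma is_mean_C_iff_fprod:
  assumes "incr_bij f" "incr_bij g"
  shows "is_mean (C f g) \<longleftrightarrow>
    fprod_converges (\<lambda>i. iter g (- int i)) \<and> (\<forall>x\<in>I1. f x = fprod (\<lambda>i. iter g (- int i)) x)"
  by (simp only: is_mean_C_iff[OF assms] mult_eq_iff_has_prod[OF assms] fprod_iff)

text \<open>Raising the exponents by one puts the factor \<open>g x\<close> in front of a product
  equal to \<open>f x\<close>. The pair \<open>f\<close>, \<open>g\<close> yields the left side of
  the functional equation, the pair \<open>g\<close>, \<open>h\<close> the function iterated on its
  right side.\<close>

lemma is_mean_C_imp_fprod_plus_1:
  assumes "incr_bij f" "incr_bij g" "is_mean (C f g)"
  shows "fprod_converges (\<lambda>i. iter g (- int i + 1)) \<and>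
    (\<forall>x\<in>I1. (f \<circ> g) x = fprod (\<lambda>i. iter g (- int i + 1)) x)"
  unfolding fprod_iff
proof (intro allI impI)
  fix x :: real assume x: "x > 1"
  have "\<forall>x>1. f (g x) = f x * g x"
    using is_mean_C_iff assms by blast
  then show "(\<lambda>i. iter g (- int i + 1) x) has_prod (f \<circ> g) x"
    using has_prod_iter_minus_plus_1[OF assms(2) x] has_prod_iter_minus[OF assms(1,2) _ x] x
    by (auto simp: mult.commute)
qed

theorem theorem4:
  fixes f g h :: "real \<Rightarrow> real"
  assumes "continuous_on I1 f" "strict_mono_on I1 f" "f ` I1 = I1"
    and "continuous_on I1 g" "strict_mono_on I1 g" "g ` I1 = I1"
    and "continuous_on I1 h" "strict_mono_on I1 h" "h ` I1 = I1"
  shows "(is_mean (C f g) \<and> is_mean (C g h) \<and> is_mean (C (f \<circ> g) (g \<circ> h)))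
    \<longleftrightarrow>
    ((fprod_converges (\<lambda>i. iter h (- int i)) \<and>
      (\<forall>x\<in>I1. g x = fprod (\<lambda>i. iter h (- int i)) x))
    \<and>
     (fprod_converges (\<lambda>j. iter (fprod (\<lambda>i. iter h (- int i))) (- int j)) \<and>
      (\<forall>x\<in>I1. f x = fprod (\<lambda>j. iter (fprod (\<lambda>i. iter h (- int i))) (- int j)) x))
    \<and>
     (fprod_converges (\<lambda>j. iter (fprod (\<lambda>i. iter h (- int i))) (- int j + 1)) \<and>
      fprod_converges (\<lambda>i. iter h (- int i + 1)) \<and>
      fprod_converges (\<lambda>k. iter (fprod (\<lambda>i. iter h (- int i + 1))) (- int k)) \<and>
      (\<forall>x\<in>I1. fprod (\<lambda>j. iter (fprod (\<lambda>i. iter h (- int i))) (- int j + 1)) x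
             = fprod (\<lambda>k. iter (fprod (\<lambda>i. iter h (- int i + 1))) (- int k)) x)))"
proof -
  have fgh: "incr_bij f" "incr_bij g" "incr_bij h"
    using assms by (simp_all add: incr_bij_def)
  note comp = incr_bij_comp[OF fgh(1,2)] incr_bij_comp[OF fgh(2,3)]
  let ?G = "fprod (\<lambda>i. iter h (- int i))"
  let ?H = "fprod (\<lambda>i. iter h (- int i + 1))"
  let ?F = "fprod (\<lambda>j. iter ?G (- int j + 1))"
  show ?thesis (is "_ \<longleftrightarrow> ?g \<and> ?f \<and> ?h")
  \<comment> \<open>The first two mean conditions are together equivalent to the two product
    formulas. Only when they hold can the functional equation be rewritten in terms of
    \<open>f\<close>, \<open>g\<close> and \<open>h\<close>.\<close>
  proof (cases "is_mean (C f g) \<and> is_mean (C g h)")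
    case True
    have g: ?g
      using is_mean_C_iff_fprod[OF fgh(2,3)] True by simp
    then have G: "iter ?G (- int n) = iter g (- int n)" for n
      by (intro iter_minus_cong) simp
    have f: ?f
      unfolding G using is_mean_C_iff_fprod[OF fgh(1,2)] True by blast
    have gh: "fprod_converges (\<lambda>i. iter h (- int i + 1))" "\<forall>x\<in>I1. (g \<circ> h) x = ?H x"
      using is_mean_C_imp_fprod_plus_1[OF fgh(2,3)] True by auto
    then have H: "iter ?H (- int n) = iter (g \<circ> h) (- int n)" for n
      by (intro iter_minus_cong) simp
    \<comment> \<open>For \<open>n = 0\<close> the iterate is \<open>?G\<close> itself, which is
      known to agree with \<open>g\<close> only on \<open>I1\<close>; hence the restriction to
      \<open>x > 1\<close>.\<close>
    have G1: "iter ?G (- int n + 1) x = iter g (- int n + 1) x" if "x > 1" for n x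
    proof (cases n)
      case 0
      then show ?thesis using g that by (simp add: iter_def)
    next
      case (Suc m)
      then show ?thesis using G[of m] by simp
    qed
    have fg: "fprod_converges (\<lambda>j. iter ?G (- int j + 1)) \<and> (\<forall>x\<in>I1. (f \<circ> g) x = ?F x)"
      using is_mean_C_imp_fprod_plus_1[OF fgh(1,2)] True G1 unfolding fprod_iff by simp
    \<comment> \<open>By \<open>fg\<close> and \<open>H\<close>, the functional equation says that
      \<open>f \<circ> g\<close> is the product of the inverse iterates of
      \<open>g \<circ> h\<close>, which is the mean criterion for this pair.\<close>
    have "is_mean (C (f \<circ> g) (g \<circ> h)) \<longleftrightarrow> ?h"
      unfolding is_mean_C_iff_fprod[OF comp] H using fg gh(1) by auto
    then show ?thesis using True g f by blast
  next
    case False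
    have "\<not> (?g \<and> ?f)"
    proof
      assume gf: "?g \<and> ?f"
      then have G: "iter ?G (- int n) = iter g (- int n)" for n
        by (intro iter_minus_cong) simp
      have "is_mean (C g h)"
        using is_mean_C_iff_fprod[OF fgh(2,3)] gf by blast
      moreover have "is_mean (C f g)"
        using is_mean_C_iff_fprod[OF fgh(1,2)] gf unfolding G by blast
      ultimately show False using False by blast
    qed
    then show ?thesis using False by blast
  qed
qed

end
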